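(* Let $n_0\in\mathbb{N}$ and let $x_1,\dots,x_{n_0},y$ be distinct commuting indeterminates over $\mathbb{C}$. Let $\alpha$ be the function defined on the set $\mathcal{E}_{x_1,\dots,x_{n_0}}=\{\varepsilon_k^{x_1,\dots,x_{n_0}}\}_{k=1}^{n_0}$ by $$\alpha\left(\varepsilon_k^{x_1,\dots,x_{n_0}}\right)=\varepsilon_k^{x_1,\dots,x_{n_0}}+\varepsilon_{k-1}^{x_1,\dots,x_{n_0}}\,y,\qquad k=1,\dots,n_0.$$ Then $\alpha$ is a well-defined injective function from $\mathcal{E}_{x_1,\dots,x_{n_0}}$ into $\mathcal{S}_{x_1,\dots,x_{n_0},y}$. Furthermore, $\alpha$ is injective from the generator set $\mathcal{E}_{x_1,\dots,x_{n_0}}$ of $\mathcal{S}_{x_1,\dots,x_{n_0}}$ into the generator set $\mathcal{E}_{x_1,\dots,x_{n_0},y}$ of $\mathcal{S}_{x_1,\dots,x_{n_0},y}$. In particular, $$\mathcal{E}_{x_1,\dots,x_{n_0},y}=\alpha\left(\mathcal{E}_{x_1,\dots,x_{n_0}}\right)\sqcup\left\{\varepsilon_{n_0}^{x_1,\dots,x_{n_0}}\,\varepsilon_1^{y}\right\},$$ where $\sqcup$ denotes disjoint union.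
   Context: For distinct commuting indeterminates $z_1,\dots,z_m$, $\mathcal{S}_{z_1,\dots,z_m}$ is the subalgebra of $\mathbb{C}[z_1,\dots,z_m]$ consisting of symmetric polynomials (invariant under all permutations of $z_1,\dots,z_m$). $\varepsilon_k^{z_1,\dots,z_m}$ is the $k$-th elementary symmetric polynomial in $z_1,\dots,z_m$ for $1\le k\le m$, with $\varepsilon_0^{z_1,\dots,z_m}=1$; in particular $\varepsilon_1^{y}=y$. The set $\mathcal{E}_{z_1,\dots,z_m}=\{\varepsilon_k^{z_1,\dots,z_m}: 1\le k\le m\}$ is the generator set of $\mathcal{S}_{z_1,\dots,z_m}$. *)

theory Defs
  imports Complex_Main "HOL-Library.Poly_Mapping" "HOL-Library.FuncSet"
    "HOL-Combinatorics.Permutations"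
begin

text \<open>
  Polynomials over the complex numbers in commuting indeterminates indexed by the natural
  numbers: finitely supported functions from monomials (finitely supported exponent vectors)
  to coefficients, with the convolution product of \<^theory>\<open>HOL-Library.Poly_Mapping\<close>.
  The polynomial ring in finitely many indeterminates is the subalgebra \<open>polys V\<close>,
  for the finite set \<open>V\<close> of their indices.
\<close>

type_synonym cpoly = "(nat \<Rightarrow>\<^sub>0 nat) \<Rightarrow>\<^sub>0 complex"

definition Const :: "complex \<Rightarrow> cpoly" where
  "Const c = Poly_Mapping.single 0 c"

definition Var :: "nat \<Rightarrow> cpoly" where
  "Var i = Poly_Mapping.single (Poly_Mapping.single i 1) 1"

definition polys :: "nat set \<Rightarrow> cpoly set" where
  "polys V = {p. \<forall>m \<in> Poly_Mapping.keys p. Poly_Mapping.keys m \<subseteq> V}"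

text \<open>The image of \<open>p\<close> under the substitution of \<open>Var (\<pi> i)\<close> for every \<open>Var i\<close>.\<close>

definition rename_vars :: "(nat \<Rightarrow> nat) \<Rightarrow> cpoly \<Rightarrow> cpoly" where
  "rename_vars \<pi> p =
     (\<Sum>m \<in> Poly_Mapping.keys p. Const (Poly_Mapping.lookup p m) * (\<Prod>i \<in> Poly_Mapping.keys m. Var (\<pi> i) ^ Poly_Mapping.lookup m i))"

definition sym_polys :: "nat set \<Rightarrow> cpoly set" where
  "sym_polys V = {p \<in> polys V. \<forall>\<pi>. \<pi> permutes V \<longrightarrow> rename_vars \<pi> p = p}"

definition elem_sym :: "nat set \<Rightarrow> nat \<Rightarrow> cpoly" where
  "elem_sym V k = (\<Sum>A | A \<subseteq> V \<and> card A = k. \<Prod>i \<in> A. Var i)"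

definition elem_syms :: "nat set \<Rightarrow> cpoly set" where
  "elem_syms V = elem_sym V ` {1..card V}"

text \<open>The unital complex subalgebra generated by \<open>G\<close>.\<close>

inductive_set generated_algebra :: "cpoly set \<Rightarrow> cpoly set" for G where
  const: "Const c \<in> generated_algebra G"
| gen: "g \<in> G \<Longrightarrow> g \<in> generated_algebra G"
| add: "p \<in> generated_algebra G \<Longrightarrow> q \<in> generated_algebra G \<Longrightarrow> p + q \<in> generated_algebra G"
| mult: "p \<in> generated_algebra G \<Longrightarrow> q \<in> generated_algebra G \<Longrightarrow> p * q \<in> generated_algebra G"

text \<open>The prescription of the values of \<open>\<alpha>\<close> on the generators; nothing is required elsewhere.\<close>

definition alpha_values :: "nat \<Rightarrow> nat set \<Rightarrow> nat \<Rightarrow> (cpoly \<Rightarrow> cpoly) \<Rightarrow> bool" where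
  "alpha_values n V y \<alpha> \<longleftrightarrow>
     (\<forall>k \<in> {1..n}. \<alpha> (elem_sym V k) = elem_sym V k + elem_sym V (k - 1) * Var y)"

lemma elem_sym_0: "finite V \<Longrightarrow> elem_sym V 0 = 1"
proof -
  assume "finite V"
  then have "{A. A \<subseteq> V \<and> card A = 0} = {{}}"
    by (auto dest: finite_subset)
  then show ?thesis
    by (simp add: elem_sym_def)
qed

lemma elem_sym_singleton: "elem_sym {y} 1 = Var y"
proof -
  have "{A. A \<subseteq> {y} \<and> card A = 1} = {{y}}"
    by (auto simp: card_1_singleton_iff)
  then show ?thesis
    by (simp add: elem_sym_def)
qed

end

theory Submission imports Defs begin

text \<open>
  The recursion \<open>\<epsilon>\<^sub>k(X, y) = \<epsilon>\<^sub>k(X) + \<epsilon>\<^sub>k\<^sub>-\<^sub>1(X) y\<close> says that \<open>\<alpha>\<close> maps the \<open>k\<close>-th generator to the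
  \<open>k\<close>-th generator, and \<open>\<epsilon>\<^sub>n\<^sub>+\<^sub>1(X, y) = \<epsilon>\<^sub>n(X) y\<close> is the only generator it misses. That the elementary
  symmetric polynomials generate is Gauss' argument: the lexicographically leading monomial \<open>m\<close> of
  a symmetric polynomial has nonincreasing exponents, hence is also the leading monomial of a
  product of elementary symmetric polynomials. Subtracting a multiple of that product lowers the
  leading monomial, and only finitely many nonincreasing exponent vectors lie below \<open>m\<close>.
\<close>

section \<open>Renaming of indeterminates\<close>

text \<open>The monomial factor in the body of \<open>rename_vars\<close>, named so that it can be
  folded.\<close>

definition mono_prod :: "(nat \<Rightarrow> nat) \<Rightarrow> (nat \<Rightarrow>\<^sub>0 nat) \<Rightarrow> cpoly" where
  "mono_prod \<pi> m = (\<Prod>i \<in> Poly_Mapping.keys m. Var (\<pi> i) ^ Poly_Mapping.lookup m i)"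

text \<open>Pushforward of an exponent vector along \<open>\<pi>\<close>: exponents at indices that
  \<open>\<pi>\<close> identifies are added.\<close>

definition ren :: "(nat \<Rightarrow> nat) \<Rightarrow> (nat \<Rightarrow>\<^sub>0 nat) \<Rightarrow> (nat \<Rightarrow>\<^sub>0 nat)" where
  "ren \<pi> m = (\<Sum>i \<in> Poly_Mapping.keys m. Poly_Mapping.single (\<pi> i) (Poly_Mapping.lookup m i))"

text \<open>The exponent vector of the squarefree monomial with support \<open>A\<close>.\<close>

definition ind :: "nat set \<Rightarrow> (nat \<Rightarrow>\<^sub>0 nat)" where
  "ind A = (\<Sum>i \<in> A. Poly_Mapping.single i 1)"

lemma prod_single:
  "(\<Prod>i\<in>A. Poly_Mapping.single (f i) (1::'b::comm_semiring_1)) = Poly_Mapping.single (\<Sum>i\<in>A. f i) 1"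
  by (induction A rule: infinite_finite_induct) (auto simp: mult_single)

lemma Var_power: "Var i ^ n = Poly_Mapping.single (Poly_Mapping.single i n) 1"
  by (induction n) (auto simp: Var_def mult_single simp flip: single_add)

lemma mono_prod_eq: "mono_prod \<pi> m = Poly_Mapping.single (ren \<pi> m) 1"
  by (simp add: mono_prod_def ren_def Var_power prod_single)

lemma ren_add: "ren \<pi> (a + b) = ren \<pi> a + ren \<pi> b"
  unfolding ren_def by (rule setsum_keys_plus_distrib) (auto simp: single_add)

lemma ren_zero [simp]: "ren \<pi> 0 = 0"
  by (simp add: ren_def)

lemma ren_single [simp]: "ren \<pi> (Poly_Mapping.single i n) = Poly_Mapping.single (\<pi> i) n"
  by (simp add: ren_def)

lemma lookup_ren:
  assumes "inj \<pi>"
  shows "Poly_Mapping.lookup (ren \<pi> m) (\<pi> i) = Poly_Mapping.lookup m i"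
proof -
  have "Poly_Mapping.lookup (ren \<pi> m) (\<pi> i) =
      (\<Sum>j\<in>Poly_Mapping.keys m. if j = i then Poly_Mapping.lookup m j else 0)"
    unfolding ren_def lookup_sum using assms
    by (intro sum.cong) (auto simp: lookup_single when_def inj_eq)
  then show ?thesis
    by (simp add: sum.delta in_keys_iff)
qed

lemma inj_ren: "inj \<pi> \<Longrightarrow> inj (ren \<pi>)"
  by (rule injI, rule poly_mapping_eqI) (metis lookup_ren)

lemma rename_vars_eq:
  "rename_vars \<pi> p =
     (\<Sum>m\<in>Poly_Mapping.keys p. Poly_Mapping.single (ren \<pi> m) (Poly_Mapping.lookup p m))"
  unfolding rename_vars_def mono_prod_def [symmetric] mono_prod_eq
  by (simp add: Const_def mult_single)

lemma lookup_rename_vars: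
  assumes "inj \<pi>"
  shows "Poly_Mapping.lookup (rename_vars \<pi> p) (ren \<pi> m) = Poly_Mapping.lookup p m"
proof -
  have "Poly_Mapping.lookup (rename_vars \<pi> p) (ren \<pi> m) =
      (\<Sum>m'\<in>Poly_Mapping.keys p. if m' = m then Poly_Mapping.lookup p m' else 0)"
    unfolding rename_vars_eq lookup_sum using inj_ren[OF assms]
    by (intro sum.cong) (auto simp: lookup_single when_def inj_eq)
  then show ?thesis
    by (simp add: sum.delta in_keys_iff)
qed

lemma rename_vars_single [simp]:
  "rename_vars \<pi> (Poly_Mapping.single m c) = Poly_Mapping.single (ren \<pi> m) c"
  by (simp add: rename_vars_eq)

lemma rename_vars_zero [simp]: "rename_vars \<pi> 0 = 0"
  by (simp add: rename_vars_eq)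

lemma rename_vars_add: "rename_vars \<pi> (p + q) = rename_vars \<pi> p + rename_vars \<pi> q"
  \<comment> \<open>Cancellation may shrink \<open>keys (p + q)\<close>. This is harmless because
    each summand is additive in the coefficient and vanishes at coefficient 0.\<close>
  unfolding rename_vars_eq by (rule setsum_keys_plus_distrib) (auto simp: single_add)

lemma rename_vars_sum: "rename_vars \<pi> (\<Sum>i\<in>A. f i) = (\<Sum>i\<in>A. rename_vars \<pi> (f i))"
  by (induction A rule: infinite_finite_induct) (auto simp: rename_vars_add)

lemma poly_mapping_sum_single:
  "(\<Sum>m\<in>Poly_Mapping.keys p. Poly_Mapping.single m (Poly_Mapping.lookup p m)) = p"
proof (rule poly_mapping_eqI)
  fix k
  have "(\<Sum>m\<in>Poly_Mapping.keys p. Poly_Mapping.lookup p m when m = k) =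
      (\<Sum>m\<in>Poly_Mapping.keys p. if m = k then Poly_Mapping.lookup p m else 0)"
    by (simp add: when_def)
  then show "Poly_Mapping.lookup
      (\<Sum>m\<in>Poly_Mapping.keys p. Poly_Mapping.single m (Poly_Mapping.lookup p m)) k =
      Poly_Mapping.lookup p k"
    by (simp add: lookup_sum lookup_single sum.delta in_keys_iff)
qed

text \<open>Both sides are bilinear, so expansion into monomials reduces the claim to
  \<open>ren_add\<close>.\<close>

lemma rename_vars_mult: "rename_vars \<pi> (p * q) = rename_vars \<pi> p * rename_vars \<pi> q"
proof -
  have "p * q = (\<Sum>a\<in>Poly_Mapping.keys p. \<Sum>b\<in>Poly_Mapping.keys q.
      Poly_Mapping.single (a + b) (Poly_Mapping.lookup p a * Poly_Mapping.lookup q b))"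
    by (subst poly_mapping_sum_single [of p, symmetric],
        subst poly_mapping_sum_single [of q, symmetric])
      (simp add: sum_product mult_single)
  also have "rename_vars \<pi> \<dots> = rename_vars \<pi> p * rename_vars \<pi> q"
    by (simp add: rename_vars_sum ren_add rename_vars_eq [of \<pi> p] rename_vars_eq [of \<pi> q]
        sum_product mult_single)
  finally show ?thesis .
qed

section \<open>Elementary symmetric polynomials\<close>

lemma lookup_ind: "finite A \<Longrightarrow> Poly_Mapping.lookup (ind A) i = (if i \<in> A then 1 else 0)"
  by (auto simp: ind_def lookup_sum lookup_single when_def)

lemma ind_inject: "finite A \<Longrightarrow> finite B \<Longrightarrow> ind A = ind B \<longleftrightarrow> A = B"
  by (metis lookup_ind subsetI subset_antisym zero_neq_one)

lemma keys_ind: "finite A \<Longrightarrow> Poly_Mapping.keys (ind A) = A"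
  by (auto simp: in_keys_iff lookup_ind split: if_splits)

lemma elem_sym_eq: "elem_sym V k = (\<Sum>A | A \<subseteq> V \<and> card A = k. Poly_Mapping.single (ind A) 1)"
  by (simp add: elem_sym_def Var_def prod_single ind_def)

text \<open>Different subsets give different squarefree monomials, so no two summands of
  \<open>elem_sym V k\<close> share a monomial.\<close>

lemma lookup_elem_sym:
  assumes "finite V" "A \<subseteq> V"
  shows "Poly_Mapping.lookup (elem_sym V k) (ind A) = (if card A = k then 1 else 0)"
proof -
  have fin: "finite {B. B \<subseteq> V \<and> card B = k}"
    using assms by simp
  have fin_sub: "finite B" if "B \<subseteq> V" for B
    using that assms(1) by (rule finite_subset)
  have "Poly_Mapping.lookup (elem_sym V k) (ind A) =
      (\<Sum>B | B \<subseteq> V \<and> card B = k. if B = A then 1 else 0)"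
    unfolding elem_sym_eq lookup_sum using assms
    by (intro sum.cong) (auto simp: lookup_single when_def ind_inject [OF fin_sub fin_sub])
  then show ?thesis
    using fin assms by (simp add: sum.delta)
qed

lemma keys_elem_sym:
  assumes "finite V" "m \<in> Poly_Mapping.keys (elem_sym V k)"
  obtains A where "A \<subseteq> V" "card A = k" "m = ind A"
proof -
  have "\<exists>A. A \<subseteq> V \<and> card A = k \<and> m = ind A"
  proof (rule ccontr)
    assume *: "\<not> ?thesis"
    have "Poly_Mapping.lookup (elem_sym V k) m = 0"
      unfolding elem_sym_eq lookup_sum
      by (intro sum.neutral) (use * in \<open>auto simp: lookup_single when_def\<close>)
    with assms show False
      by (simp add: in_keys_iff)
  qed
  with that show ?thesis by blast
qed

text \<open>For \<open>j \<le> card V\<close> some subset of size \<open>j\<close> exists; the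
  coefficient at its monomial is 1 in \<open>elem_sym V j\<close> and 0 for every other
  index.\<close>

lemma inj_on_elem_sym:
  assumes "finite V"
  shows "inj_on (elem_sym V) {0..card V}"
proof (rule inj_onI)
  fix j k assume jk: "j \<in> {0..card V}" "k \<in> {0..card V}" "elem_sym V j = elem_sym V k"
  then obtain A where "A \<subseteq> V" "card A = j"
    by (metis atLeastAtMost_iff obtain_subset_with_card_n)
  with jk assms show "j = k"
    by (metis lookup_elem_sym zero_neq_one)
qed

lemma elem_sym_gt_card:
  assumes "finite V" "card V < k"
  shows "elem_sym V k = 0"
proof -
  have "{A. A \<subseteq> V \<and> card A = k} = {}"
    using assms by (metis (mono_tags, lifting) Collect_empty_eq card_mono not_le)
  then show ?thesis
    unfolding elem_sym_def by (simp only: sum.empty)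
qed

text \<open>The subsets of size \<open>Suc k\<close> are split by membership of \<open>y\<close>;
  removing \<open>y\<close> from those that contain it leaves the subsets of \<open>V\<close> of
  size \<open>k\<close>.\<close>

lemma elem_sym_insert_Suc:
  assumes "finite V" "y \<notin> V"
  shows "elem_sym (insert y V) (Suc k) = elem_sym V (Suc k) + elem_sym V k * Var y"
proof -
  let ?S = "\<lambda>k. {A. A \<subseteq> V \<and> card A = k}"
  have fin: "finite (?S k)" for k
    using assms by simp
  have split: "{A. A \<subseteq> insert y V \<and> card A = Suc k} = ?S (Suc k) \<union> insert y ` ?S k"
  proof (intro equalityI subsetI)
    fix A assume A: "A \<in> {A. A \<subseteq> insert y V \<and> card A = Suc k}"
    show "A \<in> ?S (Suc k) \<union> insert y ` ?S k"
    proof (cases "y \<in> A")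
      case True
      moreover have "finite A"
        using A assms by (auto intro: finite_subset)
      ultimately have "A = insert y (A - {y})" "A - {y} \<in> ?S k"
        using A by (auto simp: card_Diff_singleton)
      then show ?thesis by blast
    qed (use A in auto)
  next
    fix A assume "A \<in> ?S (Suc k) \<union> insert y ` ?S k"
    then show "A \<in> {A. A \<subseteq> insert y V \<and> card A = Suc k}"
    proof
      assume "A \<in> insert y ` ?S k"
      then obtain B where "A = insert y B" "B \<subseteq> V" "card B = k"
        by blast
      moreover from this(2) assms have "finite B" "y \<notin> B"
        by (auto intro: finite_subset)
      ultimately show ?thesis by auto
    qed auto
  qed
  have "elem_sym (insert y V) (Suc k) =
      elem_sym V (Suc k) + (\<Sum>A\<in>insert y ` ?S k. \<Prod>i\<in>A. Var i)"
    unfolding elem_sym_def split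
    by (rule sum.union_disjoint) (use fin assms in auto)
  also have "(\<Sum>A\<in>insert y ` ?S k. \<Prod>i\<in>A. Var i) = (\<Sum>A\<in>?S k. \<Prod>i\<in>insert y A. Var i)"
    by (rule sum.reindex_cong [OF _ refl refl]) (use assms in \<open>auto simp: inj_on_def\<close>)
  also have "\<dots> = elem_sym V k * Var y"
    unfolding elem_sym_def sum_distrib_right
  proof (rule sum.cong [OF refl])
    fix A assume "A \<in> ?S k"
    then have "finite A" "y \<notin> A"
      using assms by (auto intro: finite_subset)
    then show "(\<Prod>i\<in>insert y A. Var i) = (\<Prod>i\<in>A. Var i) * Var y"
      by (simp add: mult.commute)
  qed
  finally show ?thesis .
qed

lemma ren_ind: "inj \<pi> \<Longrightarrow> ren \<pi> (ind A) = ind (\<pi> ` A)"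
proof -
  assume "inj \<pi>"
  then have inj: "inj_on \<pi> A"
    by (auto intro: inj_on_subset)
  have "ren \<pi> (ind A) = (\<Sum>i\<in>A. Poly_Mapping.single (\<pi> i) 1)"
    unfolding ind_def by (induction A rule: infinite_finite_induct) (auto simp: ren_add)
  then show ?thesis
    using inj by (simp add: ind_def sum.reindex)
qed

section \<open>The subalgebra of symmetric polynomials\<close>

lemma polys_Const [simp]: "Const c \<in> polys V"
  by (auto simp: polys_def Const_def)

lemma polys_add: "p \<in> polys V \<Longrightarrow> q \<in> polys V \<Longrightarrow> p + q \<in> polys V"
  using keys_add [of p q] by (auto simp: polys_def)

lemma polys_mult:
  assumes "p \<in> polys V" "q \<in> polys V"
  shows "p * q \<in> polys V"
  unfolding polys_def
proof (intro CollectI ballI)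
  fix m assume "m \<in> Poly_Mapping.keys (p * q)"
  then obtain a b where "m = a + b" "a \<in> Poly_Mapping.keys p" "b \<in> Poly_Mapping.keys q"
    using keys_mult [of p q] by blast
  then show "Poly_Mapping.keys m \<subseteq> V"
    using assms keys_add [of a b] unfolding polys_def by blast
qed

lemma Const_in_sym_polys: "Const c \<in> sym_polys V"
  by (simp add: sym_polys_def) (simp add: Const_def)

lemma sym_polys_add: "p \<in> sym_polys V \<Longrightarrow> q \<in> sym_polys V \<Longrightarrow> p + q \<in> sym_polys V"
  by (auto simp: sym_polys_def polys_add rename_vars_add)

lemma sym_polys_mult: "p \<in> sym_polys V \<Longrightarrow> q \<in> sym_polys V \<Longrightarrow> p * q \<in> sym_polys V"
  by (auto simp: sym_polys_def polys_mult rename_vars_mult)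

lemma elem_sym_in_sym_polys:
  assumes "finite V"
  shows "elem_sym V k \<in> sym_polys V"
proof -
  have "elem_sym V k \<in> polys V"
    unfolding polys_def
  proof safe
    fix m i assume "m \<in> Poly_Mapping.keys (elem_sym V k)" "i \<in> Poly_Mapping.keys m"
    moreover from this(1) obtain A where "A \<subseteq> V" "m = ind A"
      by (rule keys_elem_sym [OF assms])
    ultimately show "i \<in> V"
      using finite_subset [OF _ assms] by (auto simp: keys_ind)
  qed
  moreover have "rename_vars \<pi> (elem_sym V k) = elem_sym V k" if \<pi>: "\<pi> permutes V" for \<pi>
  proof -
    let ?S = "{A. A \<subseteq> V \<and> card A = k}"
    have inj: "inj \<pi>"
      using \<pi> by (rule permutes_inj)
    then have card: "card (\<pi> ` A) = card A" for A
      by (meson card_image inj_on_subset subset_UNIV)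
    have inj_img: "inj_on ((`) \<pi>) ?S"
      using inj by (auto simp: inj_on_def inj_image_eq_iff)
    have "(`) \<pi> ` ?S \<subseteq> ?S"
      using permutes_image [OF \<pi>] card by auto
    \<comment> \<open>An injective map of the finite family of \<open>k\<close>-subsets into itself
      is onto, so renaming only reorders the summands.\<close>
    then have img: "(`) \<pi> ` ?S = ?S"
      using assms inj_img by (intro endo_inj_surj) auto
    have "rename_vars \<pi> (elem_sym V k) = (\<Sum>A\<in>?S. Poly_Mapping.single (ind (\<pi> ` A)) 1)"
      using inj by (simp add: elem_sym_eq rename_vars_sum ren_ind)
    also have "\<dots> = (\<Sum>A\<in>(`) \<pi> ` ?S. Poly_Mapping.single (ind A) 1)"
      by (simp only: sum.reindex [OF inj_img] o_def)
    finally show ?thesis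
      by (simp only: img elem_sym_eq)
  qed
  ultimately show ?thesis
    by (simp add: sym_polys_def)
qed

lemma generated_subset_sym_polys:
  assumes "finite V"
  shows "generated_algebra (elem_syms V) \<subseteq> sym_polys V"
proof
  fix p assume "p \<in> generated_algebra (elem_syms V)"
  then show "p \<in> sym_polys V"
    using elem_sym_in_sym_polys [OF assms]
    by induction (auto simp: elem_syms_def Const_in_sym_polys sym_polys_add sym_polys_mult)
qed

section \<open>Leading monomials\<close>

text \<open>The order on exponent vectors is the lexicographic one, with smaller indices more
  significant; this fixes what "leading" means below.\<close>

lemma less_poly_mapping_iff:
  "a < b \<longleftrightarrow> (\<exists>k. Poly_Mapping.lookup a k < Poly_Mapping.lookup b k \<and>
     (\<forall>j<k. Poly_Mapping.lookup a j = Poly_Mapping.lookup b j))"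
  by transfer (simp add: less_fun_def)

text \<open>With the terms \<open>s\<close> and \<open>t\<close> at the bounds \<open>a\<close> and
  \<open>b\<close> split off, the cross terms stay strictly below \<open>a + b\<close>, because the
  order is compatible with addition.\<close>

lemma lead_mult:
  fixes f g :: cpoly
  assumes f: "\<And>m. m \<in> Poly_Mapping.keys f \<Longrightarrow> m \<le> a"
    and g: "\<And>m. m \<in> Poly_Mapping.keys g \<Longrightarrow> m \<le> b"
  shows "\<And>m. m \<in> Poly_Mapping.keys (f * g) \<Longrightarrow> m \<le> a + b"
    and "Poly_Mapping.lookup (f * g) (a + b) = Poly_Mapping.lookup f a * Poly_Mapping.lookup g b"
proof -
  show "m \<le> a + b" if "m \<in> Poly_Mapping.keys (f * g)" for m
    using that keys_mult [of f g] f g by (auto intro: add_mono)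
  define s t where "s = Poly_Mapping.single a (Poly_Mapping.lookup f a)"
    and "t = Poly_Mapping.single b (Poly_Mapping.lookup g b)"
  have fs: "m < a" if "m \<in> Poly_Mapping.keys (f - s)" for m
    using that f [of m] by (cases "m = a")
      (auto simp: s_def in_keys_iff lookup_minus lookup_single when_def)
  have gt: "m < b" if "m \<in> Poly_Mapping.keys (g - t)" for m
    using that g [of m] by (cases "m = b")
      (auto simp: t_def in_keys_iff lookup_minus lookup_single when_def)
  have "m < a + b" if "m \<in> Poly_Mapping.keys ((f - s) * g)" for m
    using that keys_mult [of "f - s" g] fs g by (auto intro: add_less_le_mono)
  then have 1: "Poly_Mapping.lookup ((f - s) * g) (a + b) = 0"
    by (auto simp: in_keys_iff)
  have "m < a + b" if "m \<in> Poly_Mapping.keys (s * (g - t))" for m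
    using that keys_mult [of s "g - t"] gt by (auto simp: s_def split: if_splits)
  then have 2: "Poly_Mapping.lookup (s * (g - t)) (a + b) = 0"
    by (auto simp: in_keys_iff)
  have "f * g = s * t + ((f - s) * g + s * (g - t))"
    by (simp add: algebra_simps)
  then have "Poly_Mapping.lookup (f * g) (a + b) = Poly_Mapping.lookup (s * t) (a + b)"
    using 1 2 by (simp add: lookup_add)
  then show "Poly_Mapping.lookup (f * g) (a + b) =
      Poly_Mapping.lookup f a * Poly_Mapping.lookup g b"
    by (simp add: s_def t_def mult_single)
qed

text \<open>These are the partitions with at most \<open>card V\<close> parts: for finite
  \<open>V\<close>, one representative of each orbit of exponent vectors under the permutations of
  \<open>V\<close>.\<close>

definition dominant :: "nat set \<Rightarrow> (nat \<Rightarrow>\<^sub>0 nat) set" where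
  "dominant V = {m. Poly_Mapping.keys m \<subseteq> V \<and>
     antimono_on V (Poly_Mapping.lookup m)}"

text \<open>By \<open>init\<close>, \<open>A\<close> is an initial segment of \<open>V\<close>, so
  among the subsets of its size it occupies the most significant indices.\<close>

lemma keys_elem_sym_le:
  assumes V: "finite V" "A \<subseteq> V"
    and init: "\<And>i j. i \<in> V \<Longrightarrow> j \<in> A \<Longrightarrow> i < j \<Longrightarrow> i \<in> A"
    and m: "m \<in> Poly_Mapping.keys (elem_sym V (card A))"
  shows "m \<le> ind A"
proof -
  from m obtain B where B: "B \<subseteq> V" "card B = card A" "m = ind B"
    by (rule keys_elem_sym [OF V(1)])
  have fin: "finite A" "finite B"
    using V B by (auto intro: finite_subset)
  show ?thesis
  proof (cases "A = B")
    case False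
    then have "A - B \<noteq> {}"
      using fin(2) B(2) card_subset_eq [of B A] by auto
    \<comment> \<open>\<open>k\<close> is the first index where \<open>A\<close> and
      \<open>B\<close> differ: below it, minimality puts the elements of \<open>A\<close> into
      \<open>B\<close>, and \<open>init\<close> those of \<open>B\<close> into
      \<open>A\<close>.\<close>
    define k where "k = Min (A - B)"
    have k: "k \<in> A - B"
      unfolding k_def using fin \<open>A - B \<noteq> {}\<close> by (intro Min_in) auto
    have "j \<in> A \<longleftrightarrow> j \<in> B" if "j < k" for j
    proof
      show "j \<in> B" if "j \<in> A"
      proof (rule ccontr)
        assume "j \<notin> B"
        with that fin have "k \<le> j"
          unfolding k_def by (intro Min_le) auto
        with \<open>j < k\<close> show False by simp
      qed
      show "j \<in> A" if "j \<in> B"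
        using that \<open>j < k\<close> k B init by blast
    qed
    then have "ind B < ind A"
      unfolding less_poly_mapping_iff using k fin by (intro exI [of _ k]) (auto simp: lookup_ind)
    with B show ?thesis by simp
  qed (use B in simp)
qed

lemma elem_sym_in_generated:
  assumes "finite V" "k \<le> card V"
  shows "elem_sym V k \<in> generated_algebra (elem_syms V)"
\<comment> \<open>\<open>elem_syms\<close> starts at index 1; at index 0 the polynomial is the
  constant 1.\<close>
proof (cases "k = 0")
  case True
  then show ?thesis
    using generated_algebra.const [of 1 "elem_syms V"] assms by (simp add: elem_sym_0 Const_def)
qed (use assms in \<open>auto intro!: generated_algebra.gen simp: elem_syms_def\<close>)

text \<open>Induction on the degree, peeling columns off the partition \<open>m\<close>: its support
  \<open>A\<close> is an initial segment of \<open>V\<close>, so \<open>elem_sym V (card A)\<close>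
  has leading monomial \<open>ind A\<close>, and \<open>m - ind A\<close> is dominant again.\<close>

lemma generated_with_leading_monomial:
  assumes V: "finite V" and "m \<in> dominant V"
  shows "\<exists>g \<in> generated_algebra (elem_syms V).
    Poly_Mapping.lookup g m = 1 \<and> (\<forall>m' \<in> Poly_Mapping.keys g. m' \<le> m)"
  using assms(2)
proof (induction "\<Sum>i\<in>V. Poly_Mapping.lookup m i" arbitrary: m rule: less_induct)
  case less
  show ?case
  proof (cases "m = 0")
    case True
    then show ?thesis
      using generated_algebra.const [of 1 "elem_syms V"]
      by (intro bexI [of _ 1]) (auto simp: Const_def)
  next
    case False
    define A where "A = Poly_Mapping.keys m"
    have A: "A \<subseteq> V" "finite A" "A \<noteq> {}"
      using less.prems False by (auto simp: A_def dominant_def)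
    have anti: "Poly_Mapping.lookup m j \<le> Poly_Mapping.lookup m i"
      if "i \<in> V" "j \<in> V" "i \<le> j" for i j
      using less.prems that by (auto simp: dominant_def monotone_on_def)
    have init: "i \<in> A" if "i \<in> V" "j \<in> A" "i < j" for i j
    proof -
      have "Poly_Mapping.lookup m j \<le> Poly_Mapping.lookup m i"
        using that A by (intro anti) auto
      with that(2) show ?thesis
        by (auto simp: A_def in_keys_iff)
    qed
    define m' where "m' = m - ind A"
    have lm': "Poly_Mapping.lookup m' i = Poly_Mapping.lookup m i - (if i \<in> A then 1 else 0)" for i
      using A by (simp add: m'_def lookup_minus lookup_ind)
    have pos: "0 < Poly_Mapping.lookup m i \<longleftrightarrow> i \<in> A" for i
      by (simp add: A_def in_keys_iff)
    \<comment> \<open>The truncated subtraction loses nothing, since 1 is taken from positive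
      exponents only.\<close>
    have m: "m = ind A + m'"
      by (rule poly_mapping_eqI) (use pos A in \<open>auto simp: lookup_add lm' lookup_ind Suc_le_eq\<close>)
    have "m' \<in> dominant V"
    proof -
      have "Poly_Mapping.keys m' \<subseteq> V"
        using A by (auto simp: in_keys_iff lm' A_def)
      moreover have "Poly_Mapping.lookup m' j \<le> Poly_Mapping.lookup m' i"
        if "i \<in> V" "j \<in> V" "i \<le> j" for i j
        using anti [OF that] pos [of i] pos [of j] by (auto simp: lm')
      ultimately show ?thesis
        by (auto simp: dominant_def monotone_on_def)
    qed
    moreover have "(\<Sum>i\<in>V. Poly_Mapping.lookup m' i) < (\<Sum>i\<in>V. Poly_Mapping.lookup m i)"
    proof (rule sum_strict_mono_ex1 [OF V])
      from A obtain i where "i \<in> A" by blast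
      with A pos [of i] show "\<exists>i\<in>V. Poly_Mapping.lookup m' i < Poly_Mapping.lookup m i"
        by (intro bexI [of _ i]) (auto simp: lm')
    qed (simp add: lm')
    ultimately obtain g where g: "g \<in> generated_algebra (elem_syms V)"
      "Poly_Mapping.lookup g m' = 1" "\<And>m''. m'' \<in> Poly_Mapping.keys g \<Longrightarrow> m'' \<le> m'"
      using less.hyps [of m'] by blast
    have le: "k \<le> ind A" if "k \<in> Poly_Mapping.keys (elem_sym V (card A))" for k
      using V A(1) _ that by (rule keys_elem_sym_le) (rule init)
    have lead: "\<forall>k\<in>Poly_Mapping.keys (elem_sym V (card A) * g). k \<le> ind A + m'"
      "Poly_Mapping.lookup (elem_sym V (card A) * g) (ind A + m') =
        Poly_Mapping.lookup (elem_sym V (card A)) (ind A) * Poly_Mapping.lookup g m'"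
      using lead_mult [of "elem_sym V (card A)" "ind A" g m'] le g(3) by blast+
    have "elem_sym V (card A) * g \<in> generated_algebra (elem_syms V)"
      using V A g by (intro generated_algebra.mult elem_sym_in_generated) (auto simp: card_mono)
    moreover have "Poly_Mapping.lookup (elem_sym V (card A) * g) m = 1"
      unfolding m lead(2) using V A g by (simp add: lookup_elem_sym)
    moreover have "\<forall>k\<in>Poly_Mapping.keys (elem_sym V (card A) * g). k \<le> m"
      unfolding m by (rule lead(1))
    ultimately show ?thesis by blast
  qed
qed

text \<open>Were a later exponent larger than an earlier one, swapping the two indeterminates would,
  by symmetry, give a larger monomial of \<open>p\<close>.\<close>

lemma leading_monomial_dominant:
  assumes p: "p \<in> sym_polys V" and m: "m \<in> Poly_Mapping.keys p"
    and max: "\<And>m'. m' \<in> Poly_Mapping.keys p \<Longrightarrow> m' \<le> m"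
  shows "m \<in> dominant V"
proof -
  have "Poly_Mapping.lookup m j \<le> Poly_Mapping.lookup m i"
    if ij: "i \<in> V" "j \<in> V" "i \<le> j" for i j
  proof (rule ccontr)
    assume less: "\<not> ?thesis"
    define \<pi> where "\<pi> = transpose i j"
    have \<pi>: "\<pi> permutes V" "inj \<pi>" "\<And>k. \<pi> (\<pi> k) = k"
      unfolding \<pi>_def using ij by (simp_all add: permutes_swap_id)
    have \<pi>_eq: "\<pi> i = j" "\<And>k. k < i \<Longrightarrow> \<pi> k = k"
      using ij by (auto simp: \<pi>_def transpose_def)
    have "Poly_Mapping.lookup p (ren \<pi> m) = Poly_Mapping.lookup p m"
      using lookup_rename_vars [OF \<pi>(2), of p m] p \<pi>(1) by (simp add: sym_polys_def)
    then have "ren \<pi> m \<le> m"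
      using m by (intro max) (simp add: in_keys_iff)
    have lr: "Poly_Mapping.lookup (ren \<pi> m) k = Poly_Mapping.lookup m (\<pi> k)" for k
      using lookup_ren [OF \<pi>(2), of m "\<pi> k"] unfolding \<pi>(3) .
    \<comment> \<open>The transposition fixes all indices below \<open>i\<close>, so the first
      change is at \<open>i\<close>, which receives the larger exponent from
      \<open>j\<close>.\<close>
    have "m < ren \<pi> m"
      unfolding less_poly_mapping_iff
    proof (intro exI conjI allI impI)
      show "Poly_Mapping.lookup m i < Poly_Mapping.lookup (ren \<pi> m) i"
        unfolding lr \<pi>_eq(1) using less by simp
      show "Poly_Mapping.lookup m k = Poly_Mapping.lookup (ren \<pi> m) k" if "k < i" for k
        unfolding lr \<pi>_eq(2) [OF that] ..
    qed
    with \<open>ren \<pi> m \<le> m\<close> show False by simp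
  qed
  moreover have "Poly_Mapping.keys m \<subseteq> V"
    using p m by (auto simp: sym_polys_def polys_def)
  ultimately show ?thesis
    by (auto simp: dominant_def monotone_on_def)
qed

text \<open>The first exponent of a dominant monomial is its largest one, and it is monotone in the
  lexicographic order, so all exponents below \<open>m\<close> are bounded by the first exponent of \<open>m\<close>.\<close>

lemma finite_dominant_le:
  assumes V: "finite V" "m \<in> dominant V"
  shows "finite {m' \<in> dominant V. m' \<le> m}"
proof (cases "V = {}")
  case True
  then have "dominant V \<subseteq> {0}"
    by (auto simp: dominant_def)
  then show ?thesis
    by (auto intro: finite_subset [of _ "{0}"])
next
  case False
  define v where "v = Min V"
  have v: "v \<in> V" "\<And>i. i \<in> V \<Longrightarrow> v \<le> i"
    using V False by (auto simp: v_def)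
  define N where "N = Poly_Mapping.lookup m v"
  \<comment> \<open>The default value 0 outside \<open>V\<close> makes this set of functions
    finite.\<close>
  let ?F = "{f :: nat \<Rightarrow> nat. \<forall>i. (i \<in> V \<longrightarrow> f i \<in> {..N}) \<and> (i \<notin> V \<longrightarrow> f i = 0)}"
  have bound: "Poly_Mapping.lookup m' \<in> ?F" if m': "m' \<in> dominant V" "m' \<le> m" for m'
  proof -
    have out: "Poly_Mapping.lookup a i = 0" if "i \<notin> V" "a \<in> dominant V" for i a
      using that by (auto simp: dominant_def in_keys_iff)
    have "Poly_Mapping.lookup m' v \<le> N"
    proof (cases "m' = m")
      case False
      with m' have "m' < m" by simp
      then obtain k where k: "Poly_Mapping.lookup m' k < Poly_Mapping.lookup m k"
        "\<And>j. j < k \<Longrightarrow> Poly_Mapping.lookup m' j = Poly_Mapping.lookup m j"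
        by (auto simp: less_poly_mapping_iff)
      \<comment> \<open>The exponent of \<open>m\<close> at \<open>k\<close> is positive, so
        \<open>k\<close> lies in \<open>V\<close>. Hence \<open>v\<close> is at or before the first
        difference, where \<open>m'\<close> does not exceed \<open>m\<close>.\<close>
      have "k \<in> V"
        using k(1) out [of k m] V by auto
      then have "v < k \<or> v = k"
        using v(2) [of k] by auto
      then show ?thesis
        using k by (auto simp: N_def)
    qed (simp add: N_def)
    moreover have "Poly_Mapping.lookup m' i \<le> Poly_Mapping.lookup m' v" if "i \<in> V" for i
      using m'(1) v(1) v(2) [OF that] that by (simp add: dominant_def monotone_on_def)
    ultimately have "Poly_Mapping.lookup m' i \<le> N" if "i \<in> V" for i
      using that le_trans by blast
    with out m' show ?thesis by simp
  qed
  have "Poly_Mapping.lookup ` {m' \<in> dominant V. m' \<le> m} \<subseteq> ?F"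
    by (intro image_subsetI bound) simp_all
  moreover have "finite ?F"
    using V by (intro finite_set_of_finite_funs) auto
  ultimately have "finite (Poly_Mapping.lookup ` {m' \<in> dominant V. m' \<le> m})"
    by (rule finite_subset)
  then show ?thesis
    by (rule finite_imageD) (intro inj_onI poly_mapping_eqI, simp)
qed

section \<open>Gauss' reduction to elementary symmetric polynomials\<close>

lemma sym_polys_subset_generated:
  assumes V: "finite V"
  shows "sym_polys V \<subseteq> generated_algebra (elem_syms V)"
proof
  fix p assume "p \<in> sym_polys V"
  then show "p \<in> generated_algebra (elem_syms V)"
  \<comment> \<open>For nonzero \<open>p\<close> the measure counts the dominant vectors up to the
    leading monomial; restricting to dominant ones keeps this set finite.\<close>
  proof (induction "card {m \<in> dominant V. \<exists>m' \<in> Poly_Mapping.keys p. m \<le> m'}"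
      arbitrary: p rule: less_induct)
    case less
    show ?case
    proof (cases "p = 0")
      case True
      then show ?thesis
        using generated_algebra.const [of 0 "elem_syms V"] by (simp add: Const_def)
    next
      case False
      define m where "m = Max (Poly_Mapping.keys p)"
      have "Poly_Mapping.keys p \<noteq> {}"
        using False by simp
      then have m: "m \<in> Poly_Mapping.keys p" "\<And>m'. m' \<in> Poly_Mapping.keys p \<Longrightarrow> m' \<le> m"
        by (auto simp: m_def)
      have dom: "m \<in> dominant V"
        using leading_monomial_dominant [OF less.prems m] .
      obtain g where g: "g \<in> generated_algebra (elem_syms V)" "Poly_Mapping.lookup g m = 1"
        "\<And>m'. m' \<in> Poly_Mapping.keys g \<Longrightarrow> m' \<le> m"
        using generated_with_leading_monomial [OF V dom] by blast
      define h where "h = Const (Poly_Mapping.lookup p m) * g"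
      \<comment> \<open>The difference \<open>p - h\<close> is written with
        \<open>Const (- 1)\<close> to match the closure under sums and products.\<close>
      define q where "q = p + Const (- 1) * h"
      have h: "h \<in> generated_algebra (elem_syms V)"
        unfolding h_def by (intro generated_algebra.mult generated_algebra.const g)
      have qh: "p = q + h"
        by (simp add: q_def Const_def single_uminus)
      \<comment> \<open>\<open>Poly_Mapping.map\<close> applies its function to nonzero coefficients
        only, hence the case split.\<close>
      have lh: "Poly_Mapping.lookup h k = Poly_Mapping.lookup p m * Poly_Mapping.lookup g k" for k
        by (cases "Poly_Mapping.lookup g k = 0")
          (auto simp: h_def Const_def Poly_Mapping.map.rep_eq when_def simp flip: mult_map_scale_conv_mult)
      have lq: "Poly_Mapping.lookup q k = Poly_Mapping.lookup p k - Poly_Mapping.lookup h k" for k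
        by (simp add: qh lookup_add)
      \<comment> \<open>Since \<open>g\<close> has coefficient 1 at \<open>m\<close>, the terms of
        \<open>p\<close> and \<open>h\<close> at \<open>m\<close> cancel.\<close>
      have q_less: "k < m" if "k \<in> Poly_Mapping.keys q" for k
      proof -
        have "k \<noteq> m"
          using that g(2) by (auto simp: in_keys_iff lq lh)
        moreover have "k \<in> Poly_Mapping.keys p \<or> k \<in> Poly_Mapping.keys g"
          using that by (auto simp: in_keys_iff lq lh)
        ultimately show ?thesis
          using m(2) g(3) by (metis order_le_less)
      qed
      have "q \<in> sym_polys V"
        unfolding q_def using h generated_subset_sym_polys [OF V]
        by (intro sym_polys_add less.prems sym_polys_mult Const_in_sym_polys) auto
      moreover have "card {k \<in> dominant V. \<exists>m' \<in> Poly_Mapping.keys q. k \<le> m'} <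
          card {k \<in> dominant V. \<exists>m' \<in> Poly_Mapping.keys p. k \<le> m'}" (is "card ?Q < card ?P")
      proof (rule psubset_card_mono)
        \<comment> \<open>The measure drops because \<open>m\<close> itself is counted for
          \<open>p\<close> but lies above every monomial of \<open>q\<close>.\<close>
        have P: "?P = {k \<in> dominant V. k \<le> m}"
          using m(1) order_trans [OF _ m(2)] by blast
        then show "finite ?P"
          using finite_dominant_le [OF V dom] by simp
        have "m \<in> ?P - ?Q"
          using m dom q_less by (auto simp: not_le)
        moreover have "?Q \<subseteq> ?P"
          unfolding P using order_trans [OF _ less_imp_le [OF q_less]] by blast
        ultimately show "?Q \<subset> ?P" by blast
      qed
      ultimately have "q \<in> generated_algebra (elem_syms V)"
        using less.hyps by blast
      with h show ?thesis
        unfolding qh by (intro generated_algebra.add)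
    qed
  qed
qed

lemma generated_algebra_elem_syms:
  "finite V \<Longrightarrow> generated_algebra (elem_syms V) = sym_polys V"
  using generated_subset_sym_polys sym_polys_subset_generated by blast

section \<open>The map \<open>\<alpha>\<close> on the generators and the one generator outside its
  image\<close>

theorem theorem3p3:
  fixes n0 :: nat and x :: "nat \<Rightarrow> nat" and y :: nat and X XY :: "nat set"
  assumes "inj_on x {1..n0}"
    and "y \<notin> x ` {1..n0}"
    and "X = x ` {1..n0}"
    and "XY = insert y X"
  shows "(\<exists>!\<alpha>. \<alpha> \<in> extensional (elem_syms X) \<and> alpha_values n0 X y \<alpha>) \<and>
    generated_algebra (elem_syms X) = sym_polys X \<and>
    generated_algebra (elem_syms XY) = sym_polys XY \<and>
    (\<forall>\<alpha>. alpha_values n0 X y \<alpha> \<longrightarrow>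
       \<alpha> \<in> elem_syms X \<rightarrow> sym_polys XY \<and>
       inj_on \<alpha> (elem_syms X) \<and>
       \<alpha> \<in> elem_syms X \<rightarrow> elem_syms XY \<and>
       elem_syms XY = \<alpha> ` elem_syms X \<union> {elem_sym X n0 * elem_sym {y} 1} \<and>
       \<alpha> ` elem_syms X \<inter> {elem_sym X n0 * elem_sym {y} 1} = {})"
proof -
  have fin: "finite X" "finite XY" and y: "y \<notin> X"
    using assms by auto
  have card: "card X = n0" "card XY = Suc n0"
    using assms fin y by (auto simp: card_image)
  have E: "elem_syms X = elem_sym X ` {1..n0}" "elem_syms XY = elem_sym XY ` {1..Suc n0}"
    by (simp_all add: elem_syms_def card)
  have injX: "inj_on (elem_sym X) {1..n0}"
    using inj_on_elem_sym [OF fin(1)] by (rule inj_on_subset) (simp add: card)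
  have injXY: "inj_on (elem_sym XY) {1..Suc n0}"
    using inj_on_elem_sym [OF fin(2)] by (rule inj_on_subset) (simp add: card)
  have rec: "elem_sym X k + elem_sym X (k - 1) * Var y = elem_sym XY k" if "k \<in> {1..n0}" for k
    using elem_sym_insert_Suc [OF fin(1) y, of "k - 1"] that assms(4) by simp
  \<comment> \<open>In the recursion at \<open>Suc n0\<close> the term
    \<open>elem_sym X (Suc n0)\<close> vanishes, leaving only the product.\<close>
  have last: "elem_sym X n0 * elem_sym {y} 1 = elem_sym XY (Suc n0)"
    using elem_sym_insert_Suc [OF fin(1) y, of n0] elem_sym_gt_card [OF fin(1), of "Suc n0"]
    by (simp add: elem_sym_singleton [simplified] assms(4) card)
  \<comment> \<open>In this form \<open>\<alpha>\<close> preserves the index, and the remaining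
    claims reduce to injectivity of \<open>elem_sym\<close> in the index.\<close>
  have values_iff: "alpha_values n0 X y \<alpha> \<longleftrightarrow>
      (\<forall>k\<in>{1..n0}. \<alpha> (elem_sym X k) = elem_sym XY k)" for \<alpha>
    by (simp add: alpha_values_def rec [simplified])
  have ex1: "\<exists>!\<alpha>. \<alpha> \<in> extensional (elem_syms X) \<and> alpha_values n0 X y \<alpha>"
  proof (rule ex1I)
    \<comment> \<open>The index is recovered from the generator, which is unambiguous by
      \<open>injX\<close>.\<close>
    let ?\<alpha> = "restrict (\<lambda>e. elem_sym XY (inv_into {1..n0} (elem_sym X) e)) (elem_syms X)"
    show ex: "?\<alpha> \<in> extensional (elem_syms X) \<and> alpha_values n0 X y ?\<alpha>"
      using injX by (auto simp: values_iff E(1))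
    show "\<alpha> = ?\<alpha>" if "\<alpha> \<in> extensional (elem_syms X) \<and> alpha_values n0 X y \<alpha>" for \<alpha>
    proof (rule extensionalityI)
      show "\<alpha> \<in> extensional (elem_syms X)" "?\<alpha> \<in> extensional (elem_syms X)"
        using that ex by simp_all
      fix e assume "e \<in> elem_syms X"
      then obtain k where k: "k \<in> {1..n0}" "e = elem_sym X k"
        unfolding E(1) by blast
      have "\<alpha> e = elem_sym XY k" "?\<alpha> e = elem_sym XY k"
        unfolding k(2) using that ex k(1) unfolding values_iff by blast+
      then show "\<alpha> e = ?\<alpha> e" by (rule trans [OF _ sym])
    qed
  qed
  have main: "\<alpha> \<in> elem_syms X \<rightarrow> sym_polys XY \<and>
       inj_on \<alpha> (elem_syms X) \<and>
       \<alpha> \<in> elem_syms X \<rightarrow> elem_syms XY \<and>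
       elem_syms XY = \<alpha> ` elem_syms X \<union> {elem_sym X n0 * elem_sym {y} 1} \<and>
       \<alpha> ` elem_syms X \<inter> {elem_sym X n0 * elem_sym {y} 1} = {}"
    if \<alpha>: "alpha_values n0 X y \<alpha>" for \<alpha>
  proof -
    have val: "\<alpha> (elem_sym X k) = elem_sym XY k" if "k \<in> {1..n0}" for k
      using \<alpha> that by (simp add: values_iff)
    have img: "\<alpha> ` elem_syms X = elem_sym XY ` {1..n0}"
      unfolding E(1) image_image by (rule image_cong) (auto simp: val)
    have "inj_on \<alpha> (elem_syms X)"
    proof (unfold E(1), intro inj_on_imageI inj_onI)
      fix j k assume jk: "j \<in> {1..n0}" "k \<in> {1..n0}"
        "(\<alpha> \<circ> elem_sym X) j = (\<alpha> \<circ> elem_sym X) k"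
      then have "elem_sym XY j = elem_sym XY k"
        using val [OF jk(1)] val [OF jk(2)] by simp
      then show "j = k"
        using jk(1,2) inj_on_eq_iff [OF injXY, of j k] by simp
    qed
    moreover have "elem_syms XY = \<alpha> ` elem_syms X \<union> {elem_sym X n0 * elem_sym {y} 1}"
      unfolding img last E(2) by (simp add: atLeastAtMostSuc_conv)
    moreover have "\<alpha> ` elem_syms X \<inter> {elem_sym X n0 * elem_sym {y} 1} = {}"
    proof -
      \<comment> \<open>Disjointness is injectivity at the additional index
        \<open>Suc n0\<close>.\<close>
      have "elem_sym XY (Suc n0) \<notin> elem_sym XY ` {1..n0}"
        using inj_on_image_mem_iff [OF injXY, of "Suc n0" "{1..n0}"] by simp
      then show ?thesis
        unfolding img last by simp
    qed
    moreover have "elem_syms XY \<subseteq> sym_polys XY"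
      using elem_sym_in_sym_polys [OF fin(2)] by (auto simp: E(2))
    ultimately show ?thesis
      by (intro conjI funcsetI) blast+
  qed
  show ?thesis
    by (rule conjI [OF ex1], rule conjI [OF generated_algebra_elem_syms [OF fin(1)]],
        rule conjI [OF generated_algebra_elem_syms [OF fin(2)]], intro allI impI, rule main)
qed

end
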